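(* Let $I$ be an ideal of a commutative ring $R$ such that $R/\sqrt{I}$ is a flat $R$-module. Then $I=\sqrt{I}$.
   Context: All rings are commutative with identity. $\sqrt{I}$ denotes the radical of the ideal $I$. *)

theory Defs
  imports "HOL-Algebra.Module" "HOL-Algebra.QuotRing" "HOL-Algebra.Free_Abelian_Groups"
begin

definition ideal_radical :: "('a, 'b) ring_scheme \<Rightarrow> 'a set \<Rightarrow> 'a set"
  where "ideal_radical R I = {x \<in> carrier R. \<exists>n::nat. 0 < n \<and> x [^]\<^bsub>R\<^esub> n \<in> I}"

text \<open>The ring \<^term>\<open>R Quot J\<close> as an \<^term>\<open>R\<close>-module. The \<open>mult\<close> and \<open>one\<close> fields of a module
  record play no role in \<^locale>\<open>module\<close>.\<close>

definition quotient_module :: "('a, 'b) ring_scheme \<Rightarrow> 'a set \<Rightarrow> ('a, 'a set) module"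
  where "quotient_module R J =
    \<lparr>carrier = carrier (R Quot J), monoid.mult = monoid.mult (R Quot J),
     one = \<one>\<^bsub>R Quot J\<^esub>, ring.zero = \<zero>\<^bsub>R Quot J\<^esub>, add = ring.add (R Quot J),
     smult = (\<lambda>r A. (J +>\<^bsub>R\<^esub> r) \<otimes>\<^bsub>R Quot J\<^esub> A)\<rparr>"

definition linear_maps ::
    "('a, 'b) ring_scheme \<Rightarrow> ('a, 'c, 'd) module_scheme \<Rightarrow> ('a, 'e, 'f) module_scheme \<Rightarrow> ('c \<Rightarrow> 'e) set"
  where "linear_maps R N N' =
    {f \<in> carrier N \<rightarrow> carrier N'.
      (\<forall>x\<in>carrier N. \<forall>y\<in>carrier N. f (x \<oplus>\<^bsub>N\<^esub> y) = f x \<oplus>\<^bsub>N'\<^esub> f y) \<and>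
      (\<forall>r\<in>carrier R. \<forall>x\<in>carrier N. f (r \<odot>\<^bsub>N\<^esub> x) = r \<odot>\<^bsub>N'\<^esub> f x)}"

text \<open>The tensor product is the free abelian group on the pairs modulo the bilinearity relations.
  Only its underlying abelian group is constructed: injectivity of a map between tensor products
  does not involve the scalar action.\<close>

definition tensor_relators ::
    "('a, 'b) ring_scheme \<Rightarrow> ('a, 'c, 'd) module_scheme \<Rightarrow> ('a, 'e, 'f) module_scheme
      \<Rightarrow> ('c \<times> 'e \<Rightarrow>\<^sub>0 int) set"
  where "tensor_relators R M N =
    {frag_of (x \<oplus>\<^bsub>M\<^esub> x', y) - frag_of (x, y) - frag_of (x', y) | x x' y.
       x \<in> carrier M \<and> x' \<in> carrier M \<and> y \<in> carrier N} \<union>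
    {frag_of (x, y \<oplus>\<^bsub>N\<^esub> y') - frag_of (x, y) - frag_of (x, y') | x y y'.
       x \<in> carrier M \<and> y \<in> carrier N \<and> y' \<in> carrier N} \<union>
    {frag_of (r \<odot>\<^bsub>M\<^esub> x, y) - frag_of (x, r \<odot>\<^bsub>N\<^esub> y) | r x y.
       r \<in> carrier R \<and> x \<in> carrier M \<and> y \<in> carrier N}"

definition tensor_null ::
    "('a, 'b) ring_scheme \<Rightarrow> ('a, 'c, 'd) module_scheme \<Rightarrow> ('a, 'e, 'f) module_scheme
      \<Rightarrow> ('c \<times> 'e \<Rightarrow>\<^sub>0 int) set"
  where "tensor_null R M N =
    generate (free_Abelian_group (carrier M \<times> carrier N)) (tensor_relators R M N)"

definition tensor_product ::
    "('a, 'b) ring_scheme \<Rightarrow> ('a, 'c, 'd) module_scheme \<Rightarrow> ('a, 'e, 'f) module_scheme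
      \<Rightarrow> ('c \<times> 'e \<Rightarrow>\<^sub>0 int) set monoid"
  where "tensor_product R M N =
    free_Abelian_group (carrier M \<times> carrier N) Mod tensor_null R M N"

text \<open>The map \<open>M \<otimes> N \<rightarrow> M \<otimes> N'\<close> induced by a linear map \<open>f : N \<rightarrow> N'\<close>. On cosets it
  is given by representatives; the lemma \<open>tensor_map_coset\<close> below shows that the union is a single coset.\<close>

definition tensor_map ::
    "('a, 'b) ring_scheme \<Rightarrow> ('a, 'c, 'd) module_scheme \<Rightarrow> ('a, 'e, 'f) module_scheme \<Rightarrow> ('e1 \<Rightarrow> 'e)
      \<Rightarrow> ('c \<times> 'e1 \<Rightarrow>\<^sub>0 int) set \<Rightarrow> ('c \<times> 'e \<Rightarrow>\<^sub>0 int) set"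
  where "tensor_map R M N' f A =
    (\<Union>c\<in>A. tensor_null R M N' #>\<^bsub>free_Abelian_group (carrier M \<times> carrier N')\<^esub>
             frag_extend (\<lambda>(x, y). frag_of (x, f y)) c)"

text \<open>\<open>M\<close> is flat if tensoring with \<open>M\<close> preserves injectivity of linear maps. HOL cannot quantify over
  all types inside a formula, so the type \<open>'n\<close> carrying the test modules is a parameter.
  Enlarging \<open>'n\<close> makes the condition stronger (\<open>flat_module_universe\<close> below). If \<open>'n\<close> is the
  type of the ring elements, the test modules include \<open>R\<close> and all its ideals, so the condition
  is already equivalent to flatness with respect to all modules, by the ideal criterion.\<close>

definition flat_module ::
    "'n itself \<Rightarrow> ('a, 'b) ring_scheme \<Rightarrow> ('a, 'c, 'd) module_scheme \<Rightarrow> bool"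
  where "flat_module U R M \<longleftrightarrow> module R M \<and>
    (\<forall>(N :: ('a, 'n) module) (N' :: ('a, 'n) module). \<forall>f \<in> linear_maps R N N'.
       module R N \<and> module R N' \<and> inj_on f (carrier N) \<longrightarrow>
       inj_on (tensor_map R M N' f) (carrier (tensor_product R M N)))"


subsection \<open>Consistency of the definitions\<close>

lemma module_quotient_module:
  assumes "cring R" "ideal J R"
  shows "module R (quotient_module R J)"
proof -
  interpret R: cring R by fact
  interpret J: ideal J R by fact
  interpret Q: cring "R Quot J"
    using J.quotient_is_cring[OF \<open>cring R\<close>] .
  have co: "J +>\<^bsub>R\<^esub> r \<in> carrier (R Quot J)" if "r \<in> carrier R" for r
    using that by (auto simp: FactRing_simps)
  have hom: "(+>\<^bsub>R\<^esub>) J \<in> ring_hom R (R Quot J)"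
    using J.rcos_ring_hom .
  have ab: "abelian_group (quotient_module R J)"
  proof (rule abelian_groupI, goal_cases)
    case (6 x)
    then have "\<ominus>\<^bsub>R Quot J\<^esub> x \<in> carrier (quotient_module R J)"
      "\<ominus>\<^bsub>R Quot J\<^esub> x \<oplus>\<^bsub>quotient_module R J\<^esub> x = \<zero>\<^bsub>quotient_module R J\<^esub>"
      by (simp_all add: quotient_module_def Q.l_neg)
    then show ?case by blast
  next
    case (4 x y)
    then show ?case using Q.a_comm by (simp add: quotient_module_def)
  qed (simp_all add: quotient_module_def Q.a_assoc)
  show ?thesis
    by (rule moduleI[OF \<open>cring R\<close> ab])
       (auto simp: quotient_module_def co Q.l_distr Q.r_distr Q.m_assoc
         ring_hom_add[OF hom] ring_hom_mult[OF hom] ring_hom_one[OF hom])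
qed

lemma frag_extend_pair_closed:
  assumes "f \<in> A \<rightarrow> B" "c \<in> carrier (free_Abelian_group (S \<times> A))"
  shows "frag_extend (\<lambda>(x, y). frag_of (x, f y)) c \<in> carrier (free_Abelian_group (S \<times> B))"
proof -
  have "Poly_Mapping.keys (frag_extend (\<lambda>(x, y). frag_of (x, f y)) c)
      \<subseteq> (\<Union>p\<in>Poly_Mapping.keys c. Poly_Mapping.keys (case p of (x, y) \<Rightarrow> frag_of (x, f y)))"
    by (rule keys_frag_extend)
  also have "\<dots> \<subseteq> S \<times> B"
    using assms by (force simp: free_Abelian_group_def)
  finally show ?thesis
    by (simp add: free_Abelian_group_def)
qed

lemma tensor_relators_closed:
  assumes "module R M" "module R N"
  shows "tensor_relators R M N \<subseteq> carrier (free_Abelian_group (carrier M \<times> carrier N))"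
proof -
  interpret M: module R M by fact
  interpret N: module R N by fact
  have *: "Poly_Mapping.keys (a - b) \<subseteq> T" 
    if "Poly_Mapping.keys a \<subseteq> T" "Poly_Mapping.keys b \<subseteq> T" for a b :: "'x \<Rightarrow>\<^sub>0 int" and T
    using that keys_diff[of a b] by blast
  show ?thesis
    unfolding tensor_relators_def
    by (intro Un_least subsetI; elim CollectE exE conjE; hypsubst; unfold carrier_free_Abelian_group_iff)
       (intro *; simp add: keys_frag_of)+
qed

lemma tensor_null_normal:
  assumes "module R M" "module R N"
  shows "tensor_null R M N \<lhd> free_Abelian_group (carrier M \<times> carrier N)"
proof -
  interpret F: comm_group "free_Abelian_group (carrier M \<times> carrier N)"
    by (rule abelian_free_Abelian_group)
  show ?thesis
    unfolding tensor_null_def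
    using F.generate_is_subgroup[OF tensor_relators_closed[OF assms]]
    by (simp add: F.normal_iff_subgroup)
qed

lemma tensor_null_closed:
  assumes "module R M" "module R N"
  shows tensor_null_carrier:
      "tensor_null R M N \<subseteq> carrier (free_Abelian_group (carrier M \<times> carrier N))"
    and tensor_null_zero: "0 \<in> tensor_null R M N"
    and tensor_null_add:
      "a \<in> tensor_null R M N \<Longrightarrow> b \<in> tensor_null R M N \<Longrightarrow> a + b \<in> tensor_null R M N"
    and tensor_null_uminus: "a \<in> tensor_null R M N \<Longrightarrow> - a \<in> tensor_null R M N"
proof -
  have S: "subgroup (tensor_null R M N) (free_Abelian_group (carrier M \<times> carrier N))"
    using tensor_null_normal[OF assms] by (rule normal_imp_subgroup)
  show c: "tensor_null R M N \<subseteq> carrier (free_Abelian_group (carrier M \<times> carrier N))"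
    using S by (rule subgroup.subset)
  show "0 \<in> tensor_null R M N"
    using subgroup.one_closed[OF S] by simp
  show "a + b \<in> tensor_null R M N" if "a \<in> tensor_null R M N" "b \<in> tensor_null R M N"
    using subgroup.m_closed[OF S that] by simp
  show "- a \<in> tensor_null R M N" if "a \<in> tensor_null R M N"
    using subgroup.m_inv_closed[OF S that] subsetD[OF c that] by simp
qed

lemma tensor_null_map:
  assumes "module R M" "module R N" "module R N'" "f \<in> linear_maps R N N'"
    and "c \<in> tensor_null R M N"
  shows "frag_extend (\<lambda>(x, y). frag_of (x, f y)) c \<in> tensor_null R M N'"
proof -
  let ?F = "frag_extend (\<lambda>(x, y). frag_of (x, f y))"
  interpret N: module R N by fact
  interpret M: module R M by fact
  have f: "f y \<in> carrier N'" if "y \<in> carrier N" for y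
    using assms that by (auto simp: linear_maps_def)
  have relator: "?F c \<in> tensor_relators R M N'" if "c \<in> tensor_relators R M N" for c
    using that unfolding tensor_relators_def
  proof (elim UnE CollectE exE conjE, goal_cases)
    case (1 x x' y)
    then have "?F c = frag_of (x \<oplus>\<^bsub>M\<^esub> x', f y) - frag_of (x, f y) - frag_of (x', f y)"
      by (simp add: frag_extend_diff)
    with 1 f show ?case by blast
  next
    case (2 x y y')
    then have "?F c = frag_of (x, f y \<oplus>\<^bsub>N'\<^esub> f y') - frag_of (x, f y) - frag_of (x, f y')"
      using assms(4) by (simp add: frag_extend_diff linear_maps_def)
    with 2 f show ?case by blast
  next
    case (3 r x y)
    then have "?F c = frag_of (r \<odot>\<^bsub>M\<^esub> x, f y) - frag_of (x, r \<odot>\<^bsub>N'\<^esub> f y)"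
      using assms(4) by (simp add: frag_extend_diff linear_maps_def)
    with 3 f show ?case by blast
  qed
  have sub: "tensor_relators R M N' \<subseteq> tensor_null R M N'"
    by (auto simp: tensor_null_def intro: generate.incl)
  from assms(5)[unfolded tensor_null_def] show ?thesis
  proof (induction rule: generate.induct)
    case one
    then show ?case using tensor_null_zero[OF assms(1,3)] by simp
  next
    case (incl h)
    then show ?case using relator sub by blast
  next
    case (inv h)
    then have "h \<in> carrier (free_Abelian_group (carrier M \<times> carrier N))"
      using tensor_relators_closed[OF assms(1,2)] by blast
    then show ?case
      using inv relator sub tensor_null_uminus[OF assms(1,3)]
      by (auto simp: frag_extend_minus)
  next
    case (eng h1 h2)
    then show ?case
      using tensor_null_add[OF assms(1,3)] by (simp add: frag_extend_add)
  qed
qed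

lemma free_Abelian_r_coset:
  "H #>\<^bsub>free_Abelian_group S\<^esub> c = (\<lambda>h. h + c) ` H"
  by (auto simp: r_coset_def)

lemma tensor_coset_eq_iff:
  assumes "module R M" "module R N"
  defines "F \<equiv> free_Abelian_group (carrier M \<times> carrier N)"
  assumes "c \<in> carrier F" "d \<in> carrier F"
  shows "tensor_null R M N #>\<^bsub>F\<^esub> c = tensor_null R M N #>\<^bsub>F\<^esub> d \<longleftrightarrow> c - d \<in> tensor_null R M N"
proof -
  note add = tensor_null_add[OF assms(1,2)] and neg = tensor_null_uminus[OF assms(1,2)]
    and zero = tensor_null_zero[OF assms(1,2)]
  show ?thesis
    unfolding F_def free_Abelian_r_coset
  proof
    assume "(\<lambda>h. h + c) ` tensor_null R M N = (\<lambda>h. h + d) ` tensor_null R M N"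
    with zero have "0 + c \<in> (\<lambda>h. h + d) ` tensor_null R M N" by blast
    then show "c - d \<in> tensor_null R M N" by auto
  next
    assume cd: "c - d \<in> tensor_null R M N"
    have "h + c \<in> (\<lambda>h. h + d) ` tensor_null R M N" if "h \<in> tensor_null R M N" for h
      using add[OF that cd] by (intro image_eqI[of _ _ "h + (c - d)"]) simp_all
    moreover have "h + d \<in> (\<lambda>h. h + c) ` tensor_null R M N" if "h \<in> tensor_null R M N" for h
      using add[OF that neg[OF cd]] by (intro image_eqI[of _ _ "h + - (c - d)"]) simp_all
    ultimately show "(\<lambda>h. h + c) ` tensor_null R M N = (\<lambda>h. h + d) ` tensor_null R M N"
      by blast
  qed
qed

lemma tensor_map_coset:
  assumes "module R M" "module R N" "module R N'" "f \<in> linear_maps R N N'"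
    and "c \<in> carrier (free_Abelian_group (carrier M \<times> carrier N))"
  shows "tensor_map R M N' f (tensor_null R M N #>\<^bsub>free_Abelian_group (carrier M \<times> carrier N)\<^esub> c) =
    tensor_null R M N' #>\<^bsub>free_Abelian_group (carrier M \<times> carrier N')\<^esub>
      frag_extend (\<lambda>(x, y). frag_of (x, f y)) c"
proof -
  let ?F = "frag_extend (\<lambda>(x, y). frag_of (x, f y))"
  have fc: "f \<in> carrier N \<rightarrow> carrier N'" using assms(4) by (simp add: linear_maps_def)
  have "tensor_null R M N' #>\<^bsub>free_Abelian_group (carrier M \<times> carrier N')\<^esub> ?F (h + c) =
      tensor_null R M N' #>\<^bsub>free_Abelian_group (carrier M \<times> carrier N')\<^esub> ?F c"
    if h: "h \<in> tensor_null R M N" for h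
  proof -
    have "?F h \<in> tensor_null R M N'" using tensor_null_map[OF assms(1-4) h] .
    moreover have "h + c \<in> carrier (free_Abelian_group (carrier M \<times> carrier N))"
      using subsetD[OF tensor_null_carrier[OF assms(1,2)] h] assms(5) keys_add[of h c] by auto
    ultimately show ?thesis
      using tensor_coset_eq_iff[OF assms(1,3) frag_extend_pair_closed[OF fc]
          frag_extend_pair_closed[OF fc assms(5)]]
      by (metis add_diff_cancel_right' frag_extend_add)
  qed
  moreover have "tensor_null R M N \<noteq> {}" using tensor_null_zero[OF assms(1,2)] by auto
  ultimately show ?thesis
    unfolding tensor_map_def free_Abelian_r_coset[of _ "tensor_null R M N" c]
    by simp
qed

lemma inj_on_tensor_map_iff:
  assumes "module R M" "module R N" "module R N'" "f \<in> linear_maps R N N'"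
  shows "inj_on (tensor_map R M N' f) (carrier (tensor_product R M N)) \<longleftrightarrow>
    (\<forall>c \<in> carrier (free_Abelian_group (carrier M \<times> carrier N)).
       frag_extend (\<lambda>(x, y). frag_of (x, f y)) c \<in> tensor_null R M N' \<longrightarrow> c \<in> tensor_null R M N)"
    (is "?L \<longleftrightarrow> ?R")
proof -
  let ?F = "frag_extend (\<lambda>(x, y). frag_of (x, f y))"
  let ?A = "free_Abelian_group (carrier M \<times> carrier N)"
  have fc: "f \<in> carrier N \<rightarrow> carrier N'" using assms(4) by (simp add: linear_maps_def)
  note cl = frag_extend_pair_closed[OF fc]
  have minus: "c - d \<in> carrier ?A" if "c \<in> carrier ?A" "d \<in> carrier ?A" for c d
    using that keys_diff[of c d] by (auto simp: free_Abelian_group_def)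
  have zero: "0 \<in> carrier ?A" by (simp add: free_Abelian_group_def)
  have eq: "tensor_map R M N' f (tensor_null R M N #>\<^bsub>?A\<^esub> c)
        = tensor_map R M N' f (tensor_null R M N #>\<^bsub>?A\<^esub> d) \<longleftrightarrow> ?F (c - d) \<in> tensor_null R M N'"
    if "c \<in> carrier ?A" "d \<in> carrier ?A" for c d
    using that tensor_coset_eq_iff[OF assms(1,3) cl cl, of c d]
    by (simp add: tensor_map_coset[OF assms] frag_extend_diff)
  have "?L \<longleftrightarrow> (\<forall>c\<in>carrier ?A. \<forall>d\<in>carrier ?A.
      ?F (c - d) \<in> tensor_null R M N' \<longrightarrow> c - d \<in> tensor_null R M N)"
    by (simp add: inj_on_def tensor_product_def carrier_FactGroup eq
        tensor_coset_eq_iff[OF assms(1,2)])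
  also have "\<dots> \<longleftrightarrow> ?R"
    using minus zero by (metis diff_zero)
  finally show ?thesis .
qed

lemma flat_module_universe:
  fixes \<iota> :: "'m \<Rightarrow> 'n"
  assumes "inj \<iota>" "flat_module TYPE('n) R M"
  shows "flat_module TYPE('m) R M"
proof -
  define j where "j = inv_into UNIV \<iota>"
  define T :: "('a, 'm) module \<Rightarrow> ('a, 'n) module" where "T N = \<lparr>carrier = \<iota> ` carrier N,
    monoid.mult = (\<lambda>x y. undefined), one = undefined, ring.zero = \<iota> (ring.zero N),
    add = (\<lambda>x y. \<iota> (ring.add N (j x) (j y))),
    smult = (\<lambda>r x. \<iota> (smult N r (j x)))\<rparr>" for N
  have j: "j (\<iota> x) = x" for x using assms(1) by (simp add: j_def)
  have M: "module R M" using assms(2) by (simp add: flat_module_def)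
  have T: "module R (T N)" if "module R N" for N
  proof -
    interpret N: module R N by fact
    have "abelian_group (T N)"
    proof (rule abelian_groupI, goal_cases)
      case (6 x)
      then obtain y where y: "x = \<iota> y" "y \<in> carrier N" by (auto simp: T_def)
      then have "\<iota> (\<ominus>\<^bsub>N\<^esub> y) \<in> carrier (T N)" by (auto simp: T_def)
      moreover have "\<iota> (\<ominus>\<^bsub>N\<^esub> y) \<oplus>\<^bsub>T N\<^esub> x = \<zero>\<^bsub>T N\<^esub>"
        using y by (simp add: T_def j N.M.l_neg)
      ultimately show ?case by blast
    qed (auto simp: T_def j N.M.a_assoc intro!: arg_cong[where f = \<iota>] N.M.a_comm)
    then show ?thesis
      by (rule moduleI[OF N.R.is_cring])
         (auto simp: T_def j N.smult_l_distr N.smult_r_distr N.smult_assoc1)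
  qed
  have \<iota>: "\<iota> \<in> linear_maps R N (T N)" for N
    by (auto simp: linear_maps_def T_def j)
  have j_lin: "j \<in> linear_maps R (T N) N" if "module R N" for N
  proof -
    interpret N: module R N by fact
    show ?thesis by (auto simp: linear_maps_def T_def j)
  qed
  show ?thesis
    unfolding flat_module_def
  proof (intro conjI allI ballI impI M; elim conjE)
    fix N N' :: "('a, 'm) module" and f
    assume f: "f \<in> linear_maps R N N'" and N: "module R N" and N': "module R N'"
      and inj: "inj_on f (carrier N)"
    interpret N: module R N by (rule N)
    define g where "g = \<iota> \<circ> f \<circ> j"
    have g: "g \<in> linear_maps R (T N) (T N')"
      using f by (auto simp: linear_maps_def g_def T_def j Pi_iff)
    have "inj_on g (carrier (T N))"
      using inj assms(1) by (auto simp: g_def T_def j inj_on_def dest: injD)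
    then have "inj_on (tensor_map R M (T N') g) (carrier (tensor_product R M (T N)))"
      using assms(2) g T[OF N] T[OF N'] unfolding flat_module_def by blast
    then have *: "c \<in> tensor_null R M (T N)"
      if "c \<in> carrier (free_Abelian_group (carrier M \<times> carrier (T N)))"
        "frag_extend (\<lambda>(x, y). frag_of (x, g y)) c \<in> tensor_null R M (T N')" for c
      using that inj_on_tensor_map_iff[OF M T[OF N] T[OF N'] g] by blast
    have comp: "frag_extend (\<lambda>(x, y). frag_of (x, q y)) (frag_extend (\<lambda>(x, y). frag_of (x, p y)) c)
        = frag_extend (\<lambda>(x, y). frag_of (x, (q \<circ> p) y)) c"
      for p :: "'p \<Rightarrow> 'q" and q :: "'q \<Rightarrow> 'r" and c :: "'c \<times> 'p \<Rightarrow>\<^sub>0 int"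
      using subset_UNIV[of "Poly_Mapping.keys c"]
      by (induction c rule: frag_induction) (auto simp: frag_extend_diff)
    show "inj_on (tensor_map R M N' f) (carrier (tensor_product R M N))"
      unfolding inj_on_tensor_map_iff[OF M N N' f]
    proof (intro ballI impI)
      fix c
      assume c: "c \<in> carrier (free_Abelian_group (carrier M \<times> carrier N))"
        and fc: "frag_extend (\<lambda>(x, y). frag_of (x, f y)) c \<in> tensor_null R M N'"
      let ?c = "frag_extend (\<lambda>(x, y). frag_of (x, \<iota> y)) c"
      have "g \<circ> \<iota> = \<iota> \<circ> f" by (auto simp: g_def j)
      then have "frag_extend (\<lambda>(x, y). frag_of (x, g y)) ?c \<in> tensor_null R M (T N')"
        using tensor_null_map[OF M N' T[OF N'] \<iota> fc] by (simp only: comp)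
      moreover have "?c \<in> carrier (free_Abelian_group (carrier M \<times> carrier (T N)))"
        using frag_extend_pair_closed[OF _ c] \<iota>[of N] by (auto simp: linear_maps_def)
      ultimately have "?c \<in> tensor_null R M (T N)" using * by blast
      then have "frag_extend (\<lambda>(x, y). frag_of (x, j y)) ?c \<in> tensor_null R M N"
        by (rule tensor_null_map[OF M T[OF N] N j_lin[OF N]])
      moreover have "j \<circ> \<iota> = id" using assms(1) by (simp add: j_def)
      moreover have "frag_extend (\<lambda>(x, y). frag_of (x, y)) c = c"
        using subset_UNIV[of "Poly_Mapping.keys c"]
      by (induction c rule: frag_induction) (auto simp: frag_extend_diff)
      ultimately show "c \<in> tensor_null R M N" by (simp only: comp id_apply)
    qed
  qed
qed

end

(* Put J = sqrt I and let x be in J. The element 1 (x) x of R/J (x) xR maps to 0 in R/J (x) R, so by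
   flatness it is 0 already. The bilinear map R/J x xR -> xR/xJ, (a + J, y) |-> a y + xJ,
   then shows that x lies in xJ, say x = x j with j in J. Hence x = x j^n for all n, and j^n lies in I
   for some n. *)
theory Submission
  imports Defs
begin

section \<open>The radical of an ideal is an ideal\<close>

text \<open>This replaces the binomial expansion by an induction on \<open>m + n\<close>. Since z(a
  + b) = za + zb, one factor \<open>a + b\<close> splits the problem into one for za, with
  \<open>m\<close> lowered by one, and one for zb, with \<open>n\<close> lowered by one. The extra
  factor \<open>z\<close> has to vary for this to go through.\<close>

lemma (in cring) ideal_radical_sum:
  fixes m n :: nat
  assumes I: "ideal I R" and a: "a \<in> carrier R" and b: "b \<in> carrier R" and z: "z \<in> carrier R"
    and "z \<otimes> a [^] m \<in> I" "z \<otimes> b [^] n \<in> I"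
  shows "\<exists>k::nat. z \<otimes> (a \<oplus> b) [^] k \<in> I"
  using z assms(5,6)
proof (induction "m + n" arbitrary: m n z)
  case 0
  then show ?case by (intro exI[of _ 0]) simp
next
  case (Suc l)
  show ?case
  proof (cases "m = 0 \<or> n = 0")
    case True
    with Suc have "z \<in> I" by auto
    with Suc.prems show ?thesis by (intro exI[of _ 0]) simp
  next
    case False
    then obtain m' n' where mn: "m = Suc m'" "n = Suc n'" by (metis not0_implies_Suc)
    have "z \<otimes> a \<otimes> a [^] m' \<in> I" "z \<otimes> b \<otimes> b [^] n' \<in> I"
      using Suc.prems mn a b by (simp_all add: m_assoc m_comm[of a] m_comm[of b])
    moreover have "z \<otimes> a \<otimes> b [^] n \<in> I" "z \<otimes> b \<otimes> a [^] m \<in> I"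
      using ideal.I_r_closed[OF I Suc.prems(3) a] ideal.I_r_closed[OF I Suc.prems(2) b] Suc.prems(1) a b
      by (simp_all add: m_assoc m_comm[of a "b [^] n"] m_comm[of b "a [^] m"])
    ultimately obtain p q :: nat
      where p: "z \<otimes> a \<otimes> (a \<oplus> b) [^] p \<in> I" and q: "z \<otimes> b \<otimes> (a \<oplus> b) [^] q \<in> I"
      using Suc.hyps(1)[of m' n "z \<otimes> a"] Suc.hyps(1)[of m n' "z \<otimes> b"] Suc.hyps(2) Suc.prems(1) mn a b
      by auto
    let ?s = "\<lambda>k::nat. (a \<oplus> b) [^] k"
    \<comment> \<open>Each summand is multiplied by the power belonging to the other, so that both
      carry the power \<open>p + q\<close> and their sum is z times the power
      \<open>p + q + 1\<close>.\<close>
    have "z \<otimes> a \<otimes> ?s p \<otimes> ?s q \<oplus> z \<otimes> b \<otimes> ?s q \<otimes> ?s p \<in> I"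
      using a b by (intro additive_subgroup.a_closed[OF ideal.axioms(1)[OF I]]
          ideal.I_r_closed[OF I p] ideal.I_r_closed[OF I q]) auto
    also have "z \<otimes> a \<otimes> ?s p \<otimes> ?s q \<oplus> z \<otimes> b \<otimes> ?s q \<otimes> ?s p = z \<otimes> ?s (Suc (p + q))"
    proof -
      have "?s (Suc (p + q)) = ?s p \<otimes> ?s q \<otimes> (a \<oplus> b)"
        using a b by (simp add: nat_pow_mult)
      moreover have "?s p \<in> carrier R" "?s q \<in> carrier R" using a b by simp_all
      ultimately show ?thesis using a b Suc.prems(1) by algebra
    qed
    finally show ?thesis by blast
  qed
qed

lemma (in cring) ideal_radical_ideal:
  assumes "ideal I R"
  shows "ideal (ideal_radical R I) R"
proof -
  interpret I: ideal I R by fact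
  have rmult: "a \<otimes> r \<in> ideal_radical R I" if "a \<in> ideal_radical R I" "r \<in> carrier R" for a r
    using that I.I_r_closed by (auto simp: ideal_radical_def nat_pow_distrib)
  have zero: "\<zero> \<in> ideal_radical R I"
    unfolding ideal_radical_def using I.zero_closed
    by (auto intro!: exI[of _ "Suc 0"])
  have add: "a \<oplus> b \<in> ideal_radical R I"
    if ab: "a \<in> ideal_radical R I" "b \<in> ideal_radical R I" for a b
  proof -
    from ab obtain m n :: nat where "a \<in> carrier R" "b \<in> carrier R" "a [^] m \<in> I" "b [^] n \<in> I"
      by (auto simp: ideal_radical_def)
    moreover from this obtain k :: nat where "\<one> \<otimes> (a \<oplus> b) [^] k \<in> I"
      using ideal_radical_sum[OF assms, of a b \<one> m n] by auto
    \<comment> \<open>The \<open>k\<close> obtained may be 0, whereas the radical asks for a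
      positive exponent; one more factor \<open>a \<oplus> b\<close> repairs this.\<close>
    ultimately have "(a \<oplus> b) [^] Suc k \<in> I" "a \<oplus> b \<in> carrier R"
      using I.I_r_closed[of "(a \<oplus> b) [^] k" "a \<oplus> b"] by auto
    then show ?thesis unfolding ideal_radical_def by blast
  qed
  have carr: "ideal_radical R I \<subseteq> carrier R" by (auto simp: ideal_radical_def)
  have neg: "\<ominus> a \<in> ideal_radical R I" if "a \<in> ideal_radical R I" for a
  proof -
    have "\<ominus> a = a \<otimes> \<ominus> \<one>" using that carr by (auto simp: r_minus)
    with rmult[OF that, of "\<ominus> \<one>"] show ?thesis by simp
  qed
  show ?thesis
  proof (rule idealI[OF ring_axioms])
    show "subgroup (ideal_radical R I) (add_monoid R)"
      using carr zero add neg by (intro add.subgroupI) (auto simp: a_inv_def)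
  qed (use carr rmult m_comm in \<open>auto simp: subset_iff\<close>)
qed

section \<open>Ideals as modules over the ring\<close>

text \<open>The elements keep the type \<open>'a\<close> of the ring elements, so ideals, and the
  ring itself as the case \<open>N = carrier R\<close>, can serve as test modules in
  \<open>flat_module TYPE('a)\<close>.\<close>

definition ideal_module :: "('a, 'b) ring_scheme \<Rightarrow> 'a set \<Rightarrow> ('a, 'a) module"
  where "ideal_module R N = \<lparr>carrier = N, monoid.mult = monoid.mult R, one = \<one>\<^bsub>R\<^esub>,
    ring.zero = \<zero>\<^bsub>R\<^esub>, add = ring.add R, smult = monoid.mult R\<rparr>"

lemma ideal_module_simps [simp]:
  "carrier (ideal_module R N) = N" "\<zero>\<^bsub>ideal_module R N\<^esub> = \<zero>\<^bsub>R\<^esub>"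
  "x \<oplus>\<^bsub>ideal_module R N\<^esub> y = x \<oplus>\<^bsub>R\<^esub> y" "x \<odot>\<^bsub>ideal_module R N\<^esub> y = x \<otimes>\<^bsub>R\<^esub> y"
  by (simp_all add: ideal_module_def)

lemma (in cring) module_ideal_module:
  assumes "ideal N R"
  shows "module R (ideal_module R N)"
proof -
  interpret N: ideal N R by fact
  note mem = N.Icarr
  have "abelian_group (ideal_module R N)"
  proof (rule abelian_groupI, goal_cases)
    case (6 x)
    then show ?case by (auto intro!: bexI[of _ "\<ominus> x"] simp: mem l_neg)
  qed (auto simp: mem a_assoc intro: a_comm)
  then show ?thesis
    by (rule moduleI[OF is_cring]) (auto simp: mem N.I_l_closed l_distr r_distr m_assoc)
qed

section \<open>Detecting when 1 (x) x vanishes\<close>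

text \<open>The preimage of \<open>K\<close> under \<open>h\<close> is a subgroup containing the
  generators. Allowing a subgroup \<open>K\<close> instead of the trivial one lets a map be bilinear
  only modulo \<open>K\<close>, so no quotient of \<open>G\<close> has to be formed.\<close>

lemma tensor_null_hom:
  assumes "module R M" "module R N" "group G"
    and h: "h \<in> hom (free_Abelian_group (carrier M \<times> carrier N)) G" and K: "subgroup K G"
    and rel: "h ` tensor_relators R M N \<subseteq> K" and c: "c \<in> tensor_null R M N"
  shows "h c \<in> K"
proof -
  interpret h: group_hom "free_Abelian_group (carrier M \<times> carrier N)" G h
    using assms(3) h by (simp add: group_hom_def group_hom_axioms_def)
  note carr = subsetD[OF tensor_relators_closed[OF assms(1,2)]]
  interpret K: subgroup K G by fact
  from c[unfolded tensor_null_def] show ?thesis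
  proof (induction rule: generate.induct)
    case (inv a)
    then show ?case using h.hom_inv[OF carr[OF inv]] rel by auto
  next
    case (eng a b)
    then have "a \<in> carrier (free_Abelian_group (carrier M \<times> carrier N))"
      "b \<in> carrier (free_Abelian_group (carrier M \<times> carrier N))"
      using subsetD[OF tensor_null_carrier[OF assms(1,2)]] by (simp_all only: tensor_null_def)
    then show ?case using h.hom_mult[of a b] eng by simp
  qed (use rel h.hom_one in auto)
qed

lemma quotient_module_simps:
  "carrier (quotient_module R J) = carrier (R Quot J)"
  "A \<oplus>\<^bsub>quotient_module R J\<^esub> B = A \<oplus>\<^bsub>R Quot J\<^esub> B"
  "r \<odot>\<^bsub>quotient_module R J\<^esub> A = (J +>\<^bsub>R\<^esub> r) \<otimes>\<^bsub>R Quot J\<^esub> A"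
  by (simp_all add: quotient_module_def)

text \<open>Here \<open>x <# J\<close> is xJ. The bilinear map into xR/xJ is realised as a map into
  the ring that multiplies \<open>y\<close> by a chosen representative of the coset. It respects the
  tensor relations modulo xJ.\<close>

lemma (in cring) tensor_quotient_principal_null:
  assumes J: "ideal J R" and x: "x \<in> carrier R"
    and null: "frag_of (J +> \<one>, x) \<in> tensor_null R (quotient_module R J) (ideal_module R (PIdl x))"
  shows "x \<in> x <# J"
proof -
  interpret J: ideal J R by fact
  let ?M = "quotient_module R J" and ?N = "ideal_module R (PIdl x)"
  have M: "module R ?M" using module_quotient_module[OF is_cring J] .
  have N: "module R ?N" using module_ideal_module[OF cgenideal_ideal[OF x]] .
  have PI: "y \<in> carrier R" if "y \<in> PIdl x" for y
    using that x by (auto simp: cgenideal_def)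
  define rep where "rep A = (SOME a. a \<in> carrier R \<and> J +> a = A)" for A
  have rep: "rep A \<in> carrier R" "J +> rep A = A" if "A \<in> carrier (R Quot J)" for A
  proof -
    from that have "\<exists>a. a \<in> carrier R \<and> J +> a = A" by (auto simp: FactRing_simps)
    then have "rep A \<in> carrier R \<and> J +> rep A = A" unfolding rep_def by (rule someI_ex)
    then show "rep A \<in> carrier R" "J +> rep A = A" by auto
  qed
  have co: "J +> r \<in> carrier (R Quot J)" if "r \<in> carrier R" for r
    using that by (auto simp: FactRing_simps)
  \<comment> \<open>A chosen representative is determined only up to \<open>J\<close>. Hence
    \<open>rep\<close> is additive and compatible with scalars up to errors in \<open>J\<close>,
    which are the next two facts.\<close>
  have repI: "rep A \<ominus> a \<in> J" if "a \<in> carrier R" "A = J +> a" for a A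
    using rep[OF co[OF that(1)]] that quotient_eq_iff_same_a_r_cos[OF J] by auto
  have rep_add: "rep (A \<oplus>\<^bsub>R Quot J\<^esub> B) \<ominus> (rep A \<oplus> rep B) \<in> J"
    if "A \<in> carrier (R Quot J)" "B \<in> carrier (R Quot J)" for A B
    using rep[OF that(1)] rep[OF that(2)] ring_hom_add[OF J.rcos_ring_hom, of "rep A" "rep B"]
    by (intro repI) auto
  have rep_smult: "rep ((J +> r) \<otimes>\<^bsub>R Quot J\<^esub> A) \<ominus> r \<otimes> rep A \<in> J"
    if "A \<in> carrier (R Quot J)" "r \<in> carrier R" for A r
    using rep[OF that(1)] that(2) ring_hom_mult[OF J.rcos_ring_hom, of r "rep A"]
    by (intro repI) auto
  have K_iff: "k \<in> x <# J \<longleftrightarrow> (\<exists>j\<in>J. k = x \<otimes> j)" for k by (auto simp: l_coset_def)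
  have K: "subgroup (x <# J) (add_monoid R)"
  proof (rule add.subgroupI, goal_cases)
    case 1 show ?case using x by (auto simp: K_iff J.Icarr)
  next
    case 2 show ?case using J.zero_closed unfolding l_coset_def by blast
  next
    case (3 a)
    then obtain j where "j \<in> J" "a = x \<otimes> j" by (auto simp: K_iff)
    then show ?case using x J.Icarr[of j]
      by (auto simp: K_iff a_inv_def[symmetric] r_minus intro!: bexI[of _ "\<ominus> j"])
  next
    case (4 a b)
    then obtain i j where "i \<in> J" "a = x \<otimes> i" "j \<in> J" "b = x \<otimes> j" by (auto simp: K_iff)
    then show ?case using x J.Icarr[of i] J.Icarr[of j]
      by (auto simp: K_iff r_distr intro!: bexI[of _ "i \<oplus> j"])
  qed
  \<comment> \<open>This absorbs the errors of \<open>rep\<close>: an error in \<open>J\<close>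
    multiplied by an element of xR lands in xJ.\<close>
  have JK: "d \<otimes> y \<in> x <# J" if d: "d \<in> J" and y: "y \<in> PIdl x" for d y
  proof -
    obtain s where s: "s \<in> carrier R" "y = s \<otimes> x" using y by (auto simp: cgenideal_def)
    then have "d \<otimes> y = x \<otimes> (d \<otimes> s)" using J.Icarr[OF d] x by algebra
    with J.I_r_closed[OF d s(1)] show ?thesis by (auto simp: K_iff)
  qed
  let ?F = "free_Abelian_group (carrier ?M \<times> (PIdl x))"
  have "(\<lambda>(A, y). rep A \<otimes> y) ` (carrier ?M \<times> (PIdl x)) \<subseteq> carrier (add_monoid R)"
    using rep PI by (auto simp: quotient_module_simps)
  from comm_group.free_Abelian_group_universal[OF a_comm_group this]
  obtain h where h: "h \<in> hom ?F (add_monoid R)"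
    and h_of: "\<And>p. p \<in> carrier ?M \<times> (PIdl x) \<Longrightarrow> h (frag_of p) = (case p of (A, y) \<Rightarrow> rep A \<otimes> y)"
    by blast
  interpret h: group_hom ?F "add_monoid R" h
    using h by (simp add: group_hom_def group_hom_axioms_def a_group)
  have h_diff: "h (u - v) = h u \<ominus> h v" if "u \<in> carrier ?F" "v \<in> carrier ?F" for u v
    using h.hom_mult[of u "- v"] h.hom_inv[of v] that
    by (simp add: a_inv_def[symmetric] minus_eq)
  have of_carr: "frag_of p \<in> carrier ?F" if "p \<in> carrier ?M \<times> (PIdl x)" for p
    using that by simp
  have diff_carr: "u - v \<in> carrier ?F" if "u \<in> carrier ?F" "v \<in> carrier ?F" for u v
    using that keys_diff[of u v] by auto
  interpret M: module R ?M by (rule M)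
  interpret N: module R ?N by (rule N)
  have "h ` tensor_relators R ?M ?N \<subseteq> x <# J"
    unfolding tensor_relators_def
  proof (intro image_subsetI; elim UnE CollectE exE conjE, goal_cases)
    \<comment> \<open>The value of \<open>h\<close> on this relator is the additivity error of
      \<open>rep\<close> times \<open>y\<close>.\<close>
    case (1 u A B y)
    have AB: "A \<oplus>\<^bsub>?M\<^esub> B \<in> carrier ?M" using 1 by simp
    with 1 have hu: "h u = rep (A \<oplus>\<^bsub>?M\<^esub> B) \<otimes> y \<ominus> rep A \<otimes> y \<ominus> rep B \<otimes> y"
      by (simp add: h_diff h_of of_carr diff_carr del: carrier_free_Abelian_group_iff)
    have mem: "rep (A \<oplus>\<^bsub>?M\<^esub> B) \<in> carrier R" "rep A \<in> carrier R" "rep B \<in> carrier R" "y \<in> carrier R"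
      using rep AB 1 PI by (simp_all add: quotient_module_simps)
    have "h u = (rep (A \<oplus>\<^bsub>?M\<^esub> B) \<ominus> (rep A \<oplus> rep B)) \<otimes> y"
      unfolding hu using mem by algebra
    then show ?case using JK rep_add[of A B] 1 by (simp add: quotient_module_simps)
  \<comment> \<open>In the second argument the map is additive exactly, because \<open>rep A\<close>
    stays fixed.\<close>
  next
    case (2 u A y y')
    have yy: "y \<oplus>\<^bsub>?N\<^esub> y' \<in> carrier ?N" using 2(3,4) by (rule N.M.a_closed)
    with 2 have hu: "h u = rep A \<otimes> (y \<oplus> y') \<ominus> rep A \<otimes> y \<ominus> rep A \<otimes> y'"
      by (simp add: h_diff h_of of_carr diff_carr del: carrier_free_Abelian_group_iff)
    have mem: "rep A \<in> carrier R" "y \<in> carrier R" "y' \<in> carrier R"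
      using rep 2 PI by (simp_all add: quotient_module_simps)
    have "h u = \<zero>"
      unfolding hu using mem by algebra
    then show ?case using subgroup.one_closed[OF K] by simp
  \<comment> \<open>Here the value is the error of \<open>rep\<close> under scalar multiplication,
    again times \<open>y\<close>.\<close>
  next
    case (3 u r A y)
    have A: "r \<odot>\<^bsub>?M\<^esub> A \<in> carrier ?M" using 3 by simp
    have y: "r \<odot>\<^bsub>?N\<^esub> y \<in> carrier ?N" using 3(2,4) by (rule N.smult_closed)
    from 3 A y have hu: "h u = rep (r \<odot>\<^bsub>?M\<^esub> A) \<otimes> y \<ominus> rep A \<otimes> (r \<otimes> y)"
      by (simp add: h_diff h_of of_carr diff_carr del: carrier_free_Abelian_group_iff)
    have mem: "rep (r \<odot>\<^bsub>?M\<^esub> A) \<in> carrier R" "rep A \<in> carrier R" "r \<in> carrier R" "y \<in> carrier R"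
      using rep A 3 PI by (simp_all add: quotient_module_simps)
    have "h u = (rep (r \<odot>\<^bsub>?M\<^esub> A) \<ominus> r \<otimes> rep A) \<otimes> y"
      unfolding hu using mem by algebra
    then show ?case using JK rep_smult[of A r] 3 by (simp add: quotient_module_simps)
  qed
  from tensor_null_hom[OF M N a_group _ K this null] h have "h (frag_of (J +> \<one>, x)) \<in> x <# J" by simp
  then have "rep (J +> \<one>) \<otimes> x \<in> x <# J"
    using h_of[of "(J +> \<one>, x)"] co cgenideal_self[OF x] by (simp add: quotient_module_simps)
  then obtain j where j: "j \<in> J" "rep (J +> \<one>) \<otimes> x = x \<otimes> j" by (auto simp: K_iff)
  \<comment> \<open>The representative chosen for the unit coset need not be 1. Its deviation
    \<open>?e\<close> lies in \<open>J\<close>, and replacing \<open>j\<close> by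
    \<open>j \<ominus> ?e\<close> turns the equation for
    \<open>rep (J +> \<one>) \<otimes> x\<close> into one for \<open>x\<close>.\<close>
  let ?e = "rep (J +> \<one>) \<ominus> \<one>"
  have e: "?e \<in> J" using repI[of \<one>] by simp
  have "x = x \<otimes> (j \<ominus> ?e)"
  proof -
    have r: "rep (J +> \<one>) \<in> carrier R" using rep co by simp
    have "x \<otimes> (j \<ominus> ?e) = x \<otimes> j \<ominus> rep (J +> \<one>) \<otimes> x \<oplus> x"
      using r x J.Icarr[OF j(1)] by algebra
    then show ?thesis using j J.Icarr[OF j(1)] x by (simp add: r_neg minus_eq)
  qed
  moreover have "j \<ominus> ?e \<in> J" using j(1) e by (simp add: minus_eq)
  ultimately show ?thesis by (auto simp: K_iff)
qed

section \<open>Applying flatness to the inclusion of xR into R\<close>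

lemma (in cring) flat_quotient_imp_mem:
  assumes J: "ideal J R" and flat: "flat_module TYPE('a) R (quotient_module R J)" and x: "x \<in> J"
  shows "x \<in> x <# J"
proof -
  interpret J: ideal J R by fact
  let ?M = "quotient_module R J" and ?N = "ideal_module R (PIdl x)"
    and ?R = "ideal_module R (carrier R)"
  have xR: "x \<in> carrier R" using x by (rule J.Icarr)
  have M: "module R ?M" using module_quotient_module[OF is_cring J] .
  have N: "module R ?N" using module_ideal_module[OF cgenideal_ideal[OF xR]] .
  have R: "module R ?R" using module_ideal_module[OF oneideal] .
  interpret M: module R ?M by (rule M)
  have PI: "PIdl x \<subseteq> carrier R" using xR by (auto simp: cgenideal_def)
  then have id: "id \<in> linear_maps R ?N ?R" by (auto simp: linear_maps_def)
  have "inj_on (tensor_map R ?M ?R id) (carrier (tensor_product R ?M ?N))"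
    using flat id N R unfolding flat_module_def by auto
  note inj = this[unfolded inj_on_tensor_map_iff[OF M N R id], rule_format]
  have one: "J +> \<one> \<in> carrier ?M" by (auto simp: quotient_module_simps FactRing_simps)
  have zero: "\<zero>\<^bsub>?M\<^esub> = J" by (simp add: quotient_module_def FactRing_def)
  have "x \<odot>\<^bsub>?M\<^esub> (J +> \<one>) = J +> x"
    using ring_hom_mult[OF J.rcos_ring_hom, of x \<one>] xR by (simp add: quotient_module_simps)
  also have "\<dots> = \<zero>\<^bsub>?M\<^esub>" using x by (simp add: zero J.a_rcos_const)
  finally have smult: "x \<odot>\<^bsub>?M\<^esub> (J +> \<one>) = \<zero>\<^bsub>?M\<^esub>" .
  have rel: "tensor_relators R ?M ?R \<subseteq> tensor_null R ?M ?R"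
    by (auto simp: tensor_null_def intro: generate.incl)
  \<comment> \<open>Since 0 + 0 = 0, this relator collapses to the negative of the generator (0, 1),
    which shows that 0 (x) 1 vanishes.\<close>
  have "frag_of (\<zero>\<^bsub>?M\<^esub> \<oplus>\<^bsub>?M\<^esub> \<zero>\<^bsub>?M\<^esub>, \<one>) - frag_of (\<zero>\<^bsub>?M\<^esub>, \<one>) - frag_of (\<zero>\<^bsub>?M\<^esub>, \<one>)
      \<in> tensor_relators R ?M ?R"
    unfolding tensor_relators_def
    by (intro UnI1 CollectI exI conjI, rule refl) simp_all
  then have n1: "- frag_of (\<zero>\<^bsub>?M\<^esub>, \<one>) \<in> tensor_null R ?M ?R"
    using subsetD[OF rel] by fastforce
  \<comment> \<open>Over the whole ring, \<open>x\<close> can be moved across the tensor sign: 1 (x)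
    x = x1 (x) 1, and x1 = 0 in the quotient by \<open>J\<close>. In xR itself the element 1 need
    not be available.\<close>
  have "frag_of (x \<odot>\<^bsub>?M\<^esub> (J +> \<one>), \<one>) - frag_of (J +> \<one>, x \<odot>\<^bsub>?R\<^esub> \<one>) \<in> tensor_relators R ?M ?R"
    unfolding tensor_relators_def
    by (intro UnI2 CollectI exI conjI, rule refl) (use one xR in simp_all)
  then have n2: "frag_of (\<zero>\<^bsub>?M\<^esub>, \<one>) - frag_of (J +> \<one>, x) \<in> tensor_null R ?M ?R"
    using subsetD[OF rel] xR by (simp add: smult)
  have "frag_of (J +> \<one>, x) \<in> tensor_null R ?M ?R"
    using tensor_null_uminus[OF M R tensor_null_add[OF M R n1 n2]] by simp
  \<comment> \<open>The map induced by \<open>id\<close> fixes this generator, so injectivity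
    carries its vanishing from R back to xR.\<close>
  then have "frag_of (J +> \<one>, x) \<in> tensor_null R ?M ?N"
    using one cgenideal_self[OF xR] by (intro inj) simp_all
  then show ?thesis by (rule tensor_quotient_principal_null[OF J xR])
qed

section \<open>Conclusion by iterating x = xj\<close>

theorem corollary3p4:
  fixes R :: "('a, 'b) ring_scheme" and I :: "'a set"
  assumes "cring R"
    and "ideal I R"
    and "flat_module TYPE('a) R (quotient_module R (ideal_radical R I))"
  shows "I = ideal_radical R I"
proof
  interpret cring R by fact
  interpret I: ideal I R by fact
  show "I \<subseteq> ideal_radical R I"
  proof
    fix x assume x: "x \<in> I"
    then have "x [^]\<^bsub>R\<^esub> Suc 0 \<in> I" using I.Icarr[OF x] by simp
    then show "x \<in> ideal_radical R I" using I.Icarr[OF x] unfolding ideal_radical_def by blast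
  qed
  show "ideal_radical R I \<subseteq> I"
  proof
    fix x assume x: "x \<in> ideal_radical R I"
    then have xR: "x \<in> carrier R" by (simp add: ideal_radical_def)
    obtain j where j: "j \<in> ideal_radical R I" "x = x \<otimes>\<^bsub>R\<^esub> j"
      using flat_quotient_imp_mem[OF ideal_radical_ideal[OF assms(2)] assms(3) x]
      by (auto simp: l_coset_def)
    then obtain n :: nat where n: "j \<in> carrier R" "j [^]\<^bsub>R\<^esub> n \<in> I"
      by (auto simp: ideal_radical_def)
    have "x \<otimes>\<^bsub>R\<^esub> j [^]\<^bsub>R\<^esub> k = x" for k :: nat
    proof (induction k)
      case (Suc k)
      have "x \<otimes>\<^bsub>R\<^esub> j [^]\<^bsub>R\<^esub> Suc k = (x \<otimes>\<^bsub>R\<^esub> j [^]\<^bsub>R\<^esub> k) \<otimes>\<^bsub>R\<^esub> j"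
        using xR n(1) by (simp add: m_assoc)
      then show ?case using Suc j(2) by simp
    qed (use xR in simp)
    then show "x \<in> I" using I.I_l_closed[OF n(2) xR] by metis
  qed
qed

end
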